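(* Let $a,b\in\mathbb{R}$ with $0<a<b$. Then for all $\alpha,\lambda\in[0,1]$, $q>1$, and $p$ with $\frac1p+\frac1q=1$, $$\left|\lambda H_\alpha^{-1}(a,b)+(1-\lambda)A_\alpha^{-1}(a,b)-L^{-1}(a,b)\right|$$ $$\le (b-a)\left(\frac{1}{p+1}\right)^{1/p}\cdot\begin{cases}(1-\alpha)^{1/q}M^{1/q}\varepsilon_1^{1/p}+\alpha^{1/q}N^{1/q}\varepsilon_3^{1/p}, & \alpha\lambda\le 1-\alpha\le 1-\lambda(1-\alpha),\\ (1-\alpha)^{1/q}M^{1/q}\varepsilon_1^{1/p}+\alpha^{1/q}N^{1/q}\varepsilon_4^{1/p}, & \alpha\lambda\le 1-\lambda(1-\alpha)\le 1-\alpha,\\ (1-\alpha)^{1/q}M^{1/q}\varepsilon_2^{1/p}+\alpha^{1/q}N^{1/q}\varepsilon_3^{1/p}, & 1-\alpha\le\alpha\lambda\le 1-\lambda(1-\alpha),\end{cases}$$ where $$M=\sup\{a^{-2q},A_\alpha(a,b)^{-2q}\},\qquad N=\sup\{b^{-2q},A_\alpha(a,b)^{-2q}\},$$ $$\varepsilon_1=(\alpha\lambda)^{p+1}+(1-\alpha-\alpha\lambda)^{p+1},\qquad \varepsilon_2=(\alpha\lambda)^{p+1}-(\alpha\lambda-1+\alpha)^{p+1},$$ $$\varepsilon_3=[\lambda(1-\alpha)]^{p+1}+[\alpha-\lambda(1-\alpha)]^{p+1},\qquad \varepsilon_4=[\lambda(1-\alpha)]^{p+1}-[\lambda(1-\a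lpha)-\alpha]^{p+1}.$$
   Context: Means, for $a,b>0$, $a\neq b$: weighted arithmetic mean $A_\alpha(a,b)=\alpha a+(1-\alpha)b$; weighted harmonic mean $H_\alpha(a,b)=\left(\frac{\alpha}{a}+\frac{1-\alpha}{b}\right)^{-1}$; logarithmic mean $L(a,b)=\frac{b-a}{\ln b-\ln a}$. The superscript $-1$ denotes the reciprocal, e.g. $L^{-1}(a,b)=1/L(a,b)$. Each $\varepsilon_i$ is only used in the cases where the bases of its powers are nonnegative. *)

theory Defs
  imports "HOL-Analysis.Analysis"
begin

definition arith_mean :: "real \<Rightarrow> real \<Rightarrow> real \<Rightarrow> real" where
  "arith_mean \<alpha> a b = \<alpha> * a + (1 - \<alpha>) * b"

definition harm_mean :: "real \<Rightarrow> real \<Rightarrow> real \<Rightarrow> real" where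
  "harm_mean \<alpha> a b = inverse (\<alpha> / a + (1 - \<alpha>) / b)"

definition log_mean :: "real \<Rightarrow> real \<Rightarrow> real" where
  "log_mean a b = (b - a) / (ln b - ln a)"

definition M_sup :: "real \<Rightarrow> real \<Rightarrow> real \<Rightarrow> real \<Rightarrow> real" where
  "M_sup \<alpha> q a b = Sup {a powr (- 2 * q), arith_mean \<alpha> a b powr (- 2 * q)}"

definition N_sup :: "real \<Rightarrow> real \<Rightarrow> real \<Rightarrow> real \<Rightarrow> real" where
  "N_sup \<alpha> q a b = Sup {b powr (- 2 * q), arith_mean \<alpha> a b powr (- 2 * q)}"

(* The functions eps1 to eps4 are meaningful only where all bases of powr are
   nonnegative; the exponent p + 1 is positive, so the convention 0 powr x = 0
   is the intended value at a zero base. *)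

definition eps1 :: "real \<Rightarrow> real \<Rightarrow> real \<Rightarrow> real" where
  "eps1 \<alpha> lam p = (\<alpha> * lam) powr (p + 1) + (1 - \<alpha> - \<alpha> * lam) powr (p + 1)"

definition eps2 :: "real \<Rightarrow> real \<Rightarrow> real \<Rightarrow> real" where
  "eps2 \<alpha> lam p = (\<alpha> * lam) powr (p + 1) - (\<alpha> * lam - 1 + \<alpha>) powr (p + 1)"

definition eps3 :: "real \<Rightarrow> real \<Rightarrow> real \<Rightarrow> real" where
  "eps3 \<alpha> lam p = (lam * (1 - \<alpha>)) powr (p + 1) + (\<alpha> - lam * (1 - \<alpha>)) powr (p + 1)"

definition eps4 :: "real \<Rightarrow> real \<Rightarrow> real \<Rightarrow> real" where
  "eps4 \<alpha> lam p = (lam * (1 - \<alpha>)) powr (p + 1) - (lam * (1 - \<alpha>) - \<alpha>) powr (p + 1)"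

end

theory Submission imports Defs begin

text \<open>Write \<open>h = b - a\<close> and let \<open>c\<close> be the weighted arithmetic mean. Integrating by parts
  on the segments from \<open>a\<close> to \<open>c\<close> and from \<open>b\<close> back to \<open>c\<close>, the quantity to be estimated
  is the sum of two integrals of the kernels \<open>t - \<alpha>\<lambda>\<close> on \<open>[0, 1 - \<alpha>]\<close> and \<open>t - \<lambda>(1 - \<alpha>)\<close> on
  \<open>[0, \<alpha>]\<close> against \<open>h\<close> times the derivative of the reciprocal function along the segment. Bound
  this derivative by its supremum, and the mean of the absolute kernel by its \<open>p\<close>-th power mean.
  The case distinction records whether the kernels change sign.\<close>

text \<open>This is Hoelder's inequality against the constant 1. It follows by integrating, along
  \<open>u\<close>, the tangent line of the convex \<open>p\<close>-th power at the mean value of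
  \<open>u\<close>.\<close>

lemma has_integral_le_power_mean:
  fixes u :: "real \<Rightarrow> real"
  assumes pq: "p > 1" "q > 1" "1 / p + 1 / q = 1"
    and "x \<le> y"
    and nonneg: "\<And>t. t \<in> {x..y} \<Longrightarrow> 0 \<le> u t"
    and I: "(u has_integral I) {x..y}"
    and J: "((\<lambda>t. u t powr p) has_integral J) {x..y}"
  shows "I \<le> (y - x) powr (1 / q) * J powr (1 / p)"
proof -
  have "0 \<le> I"
    using has_integral_nonneg[OF I] nonneg by simp
  \<comment> \<open>The mean \<open>I / d\<close> requires positive length, and powers of it are
    divided out later, so it must be positive. In the other two cases \<open>I\<close>
    vanishes.\<close>
  consider "x = y" | "I = 0" | "x < y" "0 < I"
    using \<open>x \<le> y\<close> \<open>0 \<le> I\<close> by linarith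
  then show ?thesis
  proof cases
    case 1
    then have "(u has_integral 0) {x..y}"
      by (simp add: has_integral_refl)
    then have "I = 0"
      by (rule has_integral_unique[OF I])
    then show ?thesis by simp
  next
    case 2
    then show ?thesis by simp
  next
    case 3
    define d where "d = y - x"
    define m where "m = I / d"
    have "0 < d" and "0 < m" and I_eq: "I = d * m"
      using 3 by (auto simp: d_def m_def)
    have conj: "(p - 1) * q = p"
      using pq by (simp add: field_simps)
    \<comment> \<open>Young's inequality at the mean value \<open>m\<close> is the tangent line inequality for \<open>u powr p\<close>.\<close>
    have "u t * m powr (p - 1) \<le> u t powr p / p + m powr p / q" if "t \<in> {x..y}" for t
      using Youngs_inequality[OF pq nonneg[OF that], of "m powr (p - 1)"]
      by (simp add: powr_powr conj)
    moreover have "((\<lambda>t. u t * m powr (p - 1)) has_integral I * m powr (p - 1)) {x..y}"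
      by (rule has_integral_mult_left[OF I])
    moreover have "((\<lambda>t. u t powr p / p + m powr p / q) has_integral J / p + d * (m powr p / q)) {x..y}"
      using has_integral_add[OF has_integral_divide[OF J, of p] has_integral_const_real[of "m powr p / q" x y]]
        \<open>x \<le> y\<close> by (simp add: d_def)
    ultimately have "I * m powr (p - 1) \<le> J / p + d * (m powr p / q)"
      by (blast intro: has_integral_le)
    moreover have "I * m powr (p - 1) = d * m powr p"
      using \<open>0 < m\<close> by (simp add: I_eq powr_diff)
    \<comment> \<open>Splitting by \<open>1 / p + 1 / q = 1\<close> makes the \<open>q\<close> share
      cancel against the constant term of the tangent line.\<close>
    moreover have "d * m powr p = d * m powr p * (1 / p + 1 / q)"
      by (simp add: pq)
    ultimately have "d * m powr p / p \<le> J / p"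
      by (simp add: distrib_left)
    then have "d * m powr p \<le> J"
      using pq by (simp add: divide_le_cancel)
    then have "(d * m powr p) powr (1 / p) \<le> J powr (1 / p)"
      using \<open>0 < d\<close> pq by (intro powr_mono2) auto
    then have "d powr (1 / p) * m \<le> J powr (1 / p)"
      using \<open>0 < d\<close> \<open>0 < m\<close> pq by (simp add: powr_mult powr_powr)
    \<comment> \<open>The root has left only \<open>d powr (1 / p)\<close>; the new factor completes
      it to \<open>d\<close>, and \<open>d * m\<close> is \<open>I\<close>.\<close>
    then have "d powr (1 / q) * (d powr (1 / p) * m) \<le> d powr (1 / q) * J powr (1 / p)"
      by (intro mult_left_mono) auto
    moreover have "d powr (1 / q) * (d powr (1 / p) * m) = d powr (1 / p + 1 / q) * m"
      by (simp add: powr_add)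
    moreover have "d powr (1 / p + 1 / q) * m = I"
      using \<open>0 < d\<close> by (simp add: pq I_eq)
    ultimately show ?thesis
      unfolding d_def by linarith
  qed
qed

lemma has_integral_powr_shift_right:
  fixes p k x y :: real
  assumes "p > 0" "k \<le> x" "x \<le> y"
  shows "((\<lambda>t. \<bar>t - k\<bar> powr p) has_integral
    ((y - k) powr (p + 1) - (x - k) powr (p + 1)) / (p + 1)) {x..y}"
proof -
  have "((\<lambda>t. \<bar>t - k\<bar> powr p) has_integral
      ((y - k) powr (p + 1) / (p + 1) - (x - k) powr (p + 1) / (p + 1))) {x..y}"
  \<comment> \<open>If \<open>x = k\<close>, the base \<open>t - k\<close> is zero at the left end.
    In the open interval it is positive, so the derivative rule for \<open>powr\<close>
    applies.\<close>
  proof (rule fundamental_theorem_of_calculus_interior)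
    show "continuous_on {x..y} (\<lambda>t. (t - k) powr (p + 1) / (p + 1))"
      using assms by (intro continuous_intros continuous_on_powr') auto
    fix t assume "t \<in> {x<..<y}"
    then show "((\<lambda>t. (t - k) powr (p + 1) / (p + 1)) has_vector_derivative \<bar>t - k\<bar> powr p) (at t)"
      using assms unfolding has_real_derivative_iff_has_vector_derivative[symmetric]
      by (auto intro!: derivative_eq_intros)
  qed (use assms in auto)
  then show ?thesis by (simp add: diff_divide_distrib)
qed

text \<open>Reflecting \<open>t\<close> to \<open>- t\<close> moves the zero \<open>k\<close> to the
  left of the interval, which is the previous case.\<close>

lemma has_integral_powr_shift_left:
  fixes p k x y :: real
  assumes "p > 0" "x \<le> y" "y \<le> k"
  shows "((\<lambda>t. \<bar>t - k\<bar> powr p) has_integral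
    ((k - x) powr (p + 1) - (k - y) powr (p + 1)) / (p + 1)) {x..y}"
  using has_integral_reflect_real[THEN iffD2,
      OF has_integral_powr_shift_right[of p "- k" "- y" "- x"]] assms
  by (simp add: abs_minus_commute)

text \<open>Integration by parts: the second factor is the derivative of the reciprocal of
  \<open>x + t * h\<close>, whose own primitive is a logarithm divided by \<open>h\<close>. Negative
  \<open>h\<close> is allowed, for the segment running down from \<open>b\<close>.\<close>

lemma has_integral_reciprocal_kernel:
  fixes x h d k :: real
  assumes "h \<noteq> 0" "0 \<le> d" and pos: "\<And>t. t \<in> {0..d} \<Longrightarrow> 0 < x + t * h"
  shows "((\<lambda>t. (t - k) * (- h / (x + t * h)\<^sup>2)) has_integral
    (d - k) / (x + d * h) + k / x - (ln (x + d * h) - ln x) / h) {0..d}"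
proof -
  have "((\<lambda>t. (t - k) * (- h / (x + t * h)\<^sup>2)) has_integral
      ((d - k) / (x + d * h) - ln (x + d * h) / h) - ((0 - k) / (x + 0 * h) - ln (x + 0 * h) / h)) {0..d}"
  proof (rule fundamental_theorem_of_calculus[OF \<open>0 \<le> d\<close>])
    fix t assume "t \<in> {0..d}"
    with pos have "0 < x + t * h" by blast
    then have "((\<lambda>t. (t - k) / (x + t * h) - ln (x + t * h) / h) has_real_derivative
        ((x + t * h) - (t - k) * h) / ((x + t * h) * (x + t * h)) - h / (x + t * h) / h)
        (at t within {0..d})"
      by (auto intro!: derivative_eq_intros)
    \<comment> \<open>With \<open>z\<close> for the denominator, \<open>z / (z * z)\<close> cancels
      against \<open>h / z / h\<close>.\<close>
    moreover have "(z - (t - k) * h) / (z * z) - h / z / h = (t - k) * (- h / z\<^sup>2)" if "z \<noteq> 0" for z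
      using that \<open>h \<noteq> 0\<close> by (simp add: diff_divide_distrib power2_eq_square)
    ultimately show "((\<lambda>t. (t - k) / (x + t * h) - ln (x + t * h) / h) has_vector_derivative
        (t - k) * (- h / (x + t * h)\<^sup>2)) (at t within {0..d})"
      using \<open>0 < x + t * h\<close> unfolding has_real_derivative_iff_has_vector_derivative[symmetric]
      by simp
  qed
  then show ?thesis by (simp add: diff_divide_distrib algebra_simps)
qed

lemma reciprocal_kernel_bound:
  fixes x h d k p q K J :: real
  assumes pq: "p > 1" "q > 1" "1 / p + 1 / q = 1"
    and "h \<noteq> 0" "0 \<le> d"
    and pos: "\<And>t. t \<in> {0..d} \<Longrightarrow> 0 < x + t * h"
    and K: "\<And>t. t \<in> {0..d} \<Longrightarrow> inverse ((x + t * h)\<^sup>2) \<le> K"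
    and J: "((\<lambda>t. \<bar>t - k\<bar> powr p) has_integral J) {0..d}"
  shows "\<bar>(d - k) / (x + d * h) + k / x - (ln (x + d * h) - ln x) / h\<bar>
    \<le> \<bar>h\<bar> * (d powr (1 / q) * K * J powr (1 / p))"
proof -
  define I where "I = integral {0..d} (\<lambda>t. \<bar>t - k\<bar>)"
  have I: "((\<lambda>t. \<bar>t - k\<bar>) has_integral I) {0..d}"
    unfolding I_def by (intro integrable_integral integrable_continuous_real continuous_intros)
  have "I \<le> d powr (1 / q) * J powr (1 / p)"
    using has_integral_le_power_mean[OF pq \<open>0 \<le> d\<close> _ I J] by simp
  \<comment> \<open>The bound at \<open>t = 0\<close> gives the sign of \<open>K\<close>, needed
    when the estimate of \<open>I\<close> is multiplied by \<open>\<bar>h\<bar> * K\<close>.\<close>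
  have "0 \<le> K"
    using K[of 0] \<open>0 \<le> d\<close> order_trans[of 0 "inverse (x\<^sup>2)" K] by simp
  have R: "((\<lambda>t. (t - k) * (- h / (x + t * h)\<^sup>2)) has_integral
      (d - k) / (x + d * h) + k / x - (ln (x + d * h) - ln x) / h) {0..d}"
    by (intro has_integral_reciprocal_kernel \<open>h \<noteq> 0\<close> \<open>0 \<le> d\<close> pos)
  have "norm ((t - k) * (- h / (x + t * h)\<^sup>2)) \<le> \<bar>t - k\<bar> * (\<bar>h\<bar> * K)" if "t \<in> {0..d}" for t
  proof -
    have "\<bar>h\<bar> * inverse ((x + t * h)\<^sup>2) \<le> \<bar>h\<bar> * K"
      by (intro mult_left_mono K that) auto
    then show ?thesis
      by (simp add: abs_mult mult_left_mono divide_inverse)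
  qed
  then have "norm (integral {0..d} (\<lambda>t. (t - k) * (- h / (x + t * h)\<^sup>2)))
      \<le> integral {0..d} (\<lambda>t. \<bar>t - k\<bar> * (\<bar>h\<bar> * K))"
    by (intro integral_norm_bound_integral has_integral_integrable[OF R]
        has_integral_integrable[OF has_integral_mult_left[OF I]])
  then have "\<bar>(d - k) / (x + d * h) + k / x - (ln (x + d * h) - ln x) / h\<bar> \<le> I * (\<bar>h\<bar> * K)"
    unfolding integral_unique[OF R] integral_unique[OF has_integral_mult_left[OF I]] real_norm_def .
  also have "\<dots> \<le> d powr (1 / q) * J powr (1 / p) * (\<bar>h\<bar> * K)"
    by (intro mult_right_mono mult_nonneg_nonneg abs_ge_zero) fact+
  finally show ?thesis by (simp add: mult_ac)
qed

text \<open>The inverse square decreases, so the least point \<open>w\<close> of a segment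
  dominates, and the exponent \<open>1 / q\<close> undoes \<open>q\<close>. This \<open>w\<close> is
  \<open>a\<close> for \<open>M_sup\<close> but the arithmetic mean for
  \<open>N_sup\<close>.\<close>

lemma inverse_square_le_Sup_powr:
  fixes u v w z q :: real
  assumes "0 < w" "w \<le> z" "w \<in> {u, v}" "0 < q"
  shows "inverse (z\<^sup>2) \<le> Sup {u powr (- 2 * q), v powr (- 2 * q)} powr (1 / q)"
proof -
  have "inverse (z\<^sup>2) \<le> inverse (w\<^sup>2)"
    using assms by (intro le_imp_inverse_le power_mono) auto
  also have "\<dots> = w powr (- 2)"
    using assms by (simp add: powr_minus)
  also have "\<dots> = (w powr (- 2 * q)) powr (1 / q)"
    using assms by (simp add: powr_powr)
  also have "\<dots> \<le> Sup {u powr (- 2 * q), v powr (- 2 * q)} powr (1 / q)"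
    using assms by (intro powr_mono2 cSup_upper) auto
  finally show ?thesis .
qed

text \<open>Leaving \<open>E\<close> and \<open>F\<close> abstract lets all three cases share one
  argument; they differ only in the values of the two kernel integrals.\<close>

lemma mean_difference_bound:
  fixes a b \<alpha> lam p q E F :: real
  assumes "0 < a" "a < b" "\<alpha> \<in> {0..1}"
    and pq: "p > 1" "q > 1" "1 / p + 1 / q = 1"
    and E: "((\<lambda>t. \<bar>t - \<alpha> * lam\<bar> powr p) has_integral E / (p + 1)) {0..1 - \<alpha>}"
    and F: "((\<lambda>t. \<bar>t - lam * (1 - \<alpha>)\<bar> powr p) has_integral F / (p + 1)) {0..\<alpha>}"
  shows "\<bar>lam * inverse (harm_mean \<alpha> a b) + (1 - lam) * inverse (arith_mean \<alpha> a b)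
      - inverse (log_mean a b)\<bar>
    \<le> (b - a) * (1 / (p + 1)) powr (1 / p) *
       ((1 - \<alpha>) powr (1 / q) * M_sup \<alpha> q a b powr (1 / q) * E powr (1 / p)
        + \<alpha> powr (1 / q) * N_sup \<alpha> q a b powr (1 / q) * F powr (1 / p))"
proof -
  define c where "c = arith_mean \<alpha> a b"
  have \<alpha>: "0 \<le> \<alpha>" "\<alpha> \<le> 1"
    using \<open>\<alpha> \<in> {0..1}\<close> by auto
  have c_a: "c = a + (1 - \<alpha>) * (b - a)" and c_b: "c = b + \<alpha> * (a - b)"
    by (simp_all add: c_def arith_mean_def algebra_simps)
  have "0 \<le> (1 - \<alpha>) * (b - a)"
    using \<alpha> \<open>a < b\<close> by simp
  then have "a \<le> c" by (simp add: c_a)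
  have up: "a \<le> a + t * (b - a)" if "t \<in> {0..1 - \<alpha>}" for t
    using that \<open>a < b\<close> by simp
  have down: "c \<le> b + t * (a - b)" if "t \<in> {0..\<alpha>}" for t
    using that \<open>a < b\<close> by (simp add: c_b mult_right_mono_neg)
  \<comment> \<open>These signs come from the integrals and allow \<open>1 / (p + 1)\<close> to be
    split off under the root.\<close>
  have nonneg: "0 \<le> E" "0 \<le> F"
    using has_integral_nonneg[OF E] has_integral_nonneg[OF F] pq by (simp_all add: zero_le_divide_iff)
  let ?C = "(1 / (p + 1)) powr (1 / p)"
  let ?A = "(1 - \<alpha> - \<alpha> * lam) / c + \<alpha> * lam / a - (ln c - ln a) / (b - a)"
  let ?B = "(\<alpha> - lam * (1 - \<alpha>)) / c + lam * (1 - \<alpha>) / b - (ln c - ln b) / (a - b)"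
  have split: "(E / (p + 1)) powr (1 / p) = ?C * E powr (1 / p)"
    "(F / (p + 1)) powr (1 / p) = ?C * F powr (1 / p)"
    using nonneg pq by (simp_all add: powr_divide)
  have "\<bar>?A\<bar> \<le> \<bar>b - a\<bar> * ((1 - \<alpha>) powr (1 / q) * M_sup \<alpha> q a b powr (1 / q) * (E / (p + 1)) powr (1 / p))"
    unfolding c_a
  proof (rule reciprocal_kernel_bound[OF pq _ _ _ _ E])
    fix t assume t: "t \<in> {0..1 - \<alpha>}"
    show "0 < a + t * (b - a)"
      using up[OF t] \<open>0 < a\<close> by linarith
    show "inverse ((a + t * (b - a))\<^sup>2) \<le> M_sup \<alpha> q a b powr (1 / q)"
      unfolding M_sup_def using up[OF t] \<open>0 < a\<close> pq
      by (intro inverse_square_le_Sup_powr[where w = a]) auto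
  qed (use \<alpha> \<open>a < b\<close> in auto)
  moreover have "\<bar>?B\<bar> \<le> \<bar>a - b\<bar> * (\<alpha> powr (1 / q) * N_sup \<alpha> q a b powr (1 / q) * (F / (p + 1)) powr (1 / p))"
    unfolding c_b
  proof (rule reciprocal_kernel_bound[OF pq _ _ _ _ F])
    fix t assume t: "t \<in> {0..\<alpha>}"
    show "0 < b + t * (a - b)"
      using down[OF t] \<open>a \<le> c\<close> \<open>0 < a\<close> by linarith
    show "inverse ((b + t * (a - b))\<^sup>2) \<le> N_sup \<alpha> q a b powr (1 / q)"
      unfolding N_sup_def using down[OF t] \<open>a \<le> c\<close> \<open>0 < a\<close> pq
      by (intro inverse_square_le_Sup_powr[where w = c]) (auto simp: c_def)
  qed (use \<alpha> \<open>a < b\<close> in auto)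
  \<comment> \<open>In the sum \<open>ln c\<close> cancels, the terms over \<open>c\<close> give the
    arithmetic mean, and those over \<open>a\<close> and \<open>b\<close> give the harmonic
    mean.\<close>
  moreover have "lam * inverse (harm_mean \<alpha> a b) + (1 - lam) * inverse (arith_mean \<alpha> a b)
      - inverse (log_mean a b) = ?A + ?B"
  proof -
    have "(ln c - ln a) / (b - a) + (ln c - ln b) / (a - b) = (ln b - ln a) / (b - a)"
      unfolding minus_diff_eq[of b a, symmetric] divide_minus_right
      by (simp add: diff_divide_distrib)
    moreover have "(1 - \<alpha> - \<alpha> * lam) / c + (\<alpha> - lam * (1 - \<alpha>)) / c = (1 - lam) / c"
      by (simp add: add_divide_distrib[symmetric] algebra_simps)
    moreover have "lam * inverse (harm_mean \<alpha> a b) = \<alpha> * lam / a + lam * (1 - \<alpha>) / b"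
      by (simp add: harm_mean_def distrib_left)
    moreover have "inverse (log_mean a b) = (ln b - ln a) / (b - a)"
      by (simp add: log_mean_def)
    moreover have "(1 - lam) * inverse (arith_mean \<alpha> a b) = (1 - lam) / c"
      by (simp add: c_def divide_inverse)
    ultimately show ?thesis by linarith
  qed
  ultimately show ?thesis
    using \<open>a < b\<close> unfolding split by (simp add: algebra_simps)
qed

text \<open>The interval is cut at the sign change \<open>k\<close>, where both primitives vanish
  because \<open>0 powr (p + 1) = 0\<close>.\<close>

lemma has_integral_powr_kernel_inside:
  fixes p k d :: real
  assumes "p > 0" "0 \<le> k" "k \<le> d"
  shows "((\<lambda>t. \<bar>t - k\<bar> powr p) has_integral
    (k powr (p + 1) + (d - k) powr (p + 1)) / (p + 1)) {0..d}"
  using has_integral_combine[OF assms(2,3) has_integral_powr_shift_left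
      has_integral_powr_shift_right] assms
  by (simp add: add_divide_distrib)

theorem proposition4:
  fixes a b \<alpha> lam p q :: real
  assumes "0 < a" and "a < b"
    and "\<alpha> \<in> {0..1}" and "lam \<in> {0..1}"
    and "q > 1" and "1 / p + 1 / q = 1"
  shows
    "(\<alpha> * lam \<le> 1 - \<alpha> \<and> 1 - \<alpha> \<le> 1 - lam * (1 - \<alpha>) \<longrightarrow>
       \<bar>lam * inverse (harm_mean \<alpha> a b) + (1 - lam) * inverse (arith_mean \<alpha> a b) - inverse (log_mean a b)\<bar>
       \<le> (b - a) * (1 / (p + 1)) powr (1 / p) *
         ((1 - \<alpha>) powr (1 / q) * M_sup \<alpha> q a b powr (1 / q) * eps1 \<alpha> lam p powr (1 / p)
          + \<alpha> powr (1 / q) * N_sup \<alpha> q a b powr (1 / q) * eps3 \<alpha> lam p powr (1 / p)))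
     \<and> (\<alpha> * lam \<le> 1 - lam * (1 - \<alpha>) \<and> 1 - lam * (1 - \<alpha>) \<le> 1 - \<alpha> \<longrightarrow>
       \<bar>lam * inverse (harm_mean \<alpha> a b) + (1 - lam) * inverse (arith_mean \<alpha> a b) - inverse (log_mean a b)\<bar>
       \<le> (b - a) * (1 / (p + 1)) powr (1 / p) *
         ((1 - \<alpha>) powr (1 / q) * M_sup \<alpha> q a b powr (1 / q) * eps1 \<alpha> lam p powr (1 / p)
          + \<alpha> powr (1 / q) * N_sup \<alpha> q a b powr (1 / q) * eps4 \<alpha> lam p powr (1 / p)))
     \<and> (1 - \<alpha> \<le> \<alpha> * lam \<and> \<alpha> * lam \<le> 1 - lam * (1 - \<alpha>) \<longrightarrow>
       \<bar>lam * inverse (harm_mean \<alpha> a b) + (1 - lam) * inverse (arith_mean \<alpha> a b) - inverse (log_mean a b)\<bar>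
       \<le> (b - a) * (1 / (p + 1)) powr (1 / p) *
         ((1 - \<alpha>) powr (1 / q) * M_sup \<alpha> q a b powr (1 / q) * eps2 \<alpha> lam p powr (1 / p)
          + \<alpha> powr (1 / q) * N_sup \<alpha> q a b powr (1 / q) * eps3 \<alpha> lam p powr (1 / p)))"
proof -
  have bounds: "0 \<le> \<alpha>" "\<alpha> \<le> 1" "0 \<le> lam" "lam \<le> 1"
    using assms by auto
  then have nonneg: "0 \<le> \<alpha> * lam" "0 \<le> lam * (1 - \<alpha>)"
    by simp_all
  \<comment> \<open>Conjugacy puts \<open>1 / p\<close> strictly between 0 and 1, which yields
    \<open>p > 1\<close> and excludes \<open>p = 0\<close>, where \<open>1 / p\<close> would be
    0.\<close>
  have "1 / q < 1"
    using \<open>q > 1\<close> by simp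
  then have "0 < 1 / p" "1 / p < 1"
    using \<open>1 / p + 1 / q = 1\<close> \<open>q > 1\<close> by (smt (verit) divide_pos_pos)+
  then have "p > 1"
    by (simp add: field_simps)
  note bound = mean_difference_bound[OF assms(1-3) \<open>p > 1\<close> assms(5,6)]
  have eps1: "((\<lambda>t. \<bar>t - \<alpha> * lam\<bar> powr p) has_integral eps1 \<alpha> lam p / (p + 1)) {0..1 - \<alpha>}"
    if "\<alpha> * lam \<le> 1 - \<alpha>"
    using has_integral_powr_kernel_inside[OF _ nonneg(1) that] \<open>p > 1\<close> by (simp add: eps1_def)
  have eps2: "((\<lambda>t. \<bar>t - \<alpha> * lam\<bar> powr p) has_integral eps2 \<alpha> lam p / (p + 1)) {0..1 - \<alpha>}"
    if "1 - \<alpha> \<le> \<alpha> * lam"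
    using has_integral_powr_shift_left[OF _ _ that, of p 0] \<open>p > 1\<close> bounds
    by (simp add: eps2_def algebra_simps)
  have eps3: "((\<lambda>t. \<bar>t - lam * (1 - \<alpha>)\<bar> powr p) has_integral eps3 \<alpha> lam p / (p + 1)) {0..\<alpha>}"
    if "1 - \<alpha> \<le> 1 - lam * (1 - \<alpha>)"
    using has_integral_powr_kernel_inside[OF _ nonneg(2), of p \<alpha>] that \<open>p > 1\<close> by (simp add: eps3_def)
  have eps4: "((\<lambda>t. \<bar>t - lam * (1 - \<alpha>)\<bar> powr p) has_integral eps4 \<alpha> lam p / (p + 1)) {0..\<alpha>}"
    if "1 - lam * (1 - \<alpha>) \<le> 1 - \<alpha>"
    using has_integral_powr_shift_left[of p 0 \<alpha> "lam * (1 - \<alpha>)"] that \<open>p > 1\<close> bounds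
    by (simp add: eps4_def)
  show ?thesis
    \<comment> \<open>In the second and third cases one of the two kernel conditions follows by
      chaining both inequalities of the case.\<close>
    by (intro conjI impI bound) (auto intro: eps1 eps2 eps3 eps4)
qed

end
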